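(* Let $d\ge 1$ be an integer and let $1\leq p<q<\infty$. Let $\mathcal{M}^p_q=\mathcal{M}^p_q(\mathbb{R}^d)$ be the (classical) Morrey space. Then, for every $\delta>0$, there exist $F,K,U\in \mathcal{M}^p_q$ (depending on $\delta$) with $\|F\|_{\mathcal{M}^p_q}=\|K\|_{\mathcal{M}^p_q}=\|U\|_{\mathcal{M}^p_q}=1$ such that $$\|F\pm K\pm U\|_{\mathcal{M}^p_q}> 3(1-\delta)$$ for all (four) choices of signs.
   Context: For $a\in\mathbb{R}^d$ and $R>0$, $B(a,R)$ is the open ball in $\mathbb{R}^d$ with center $a$ and radius $R$, and $|B(a,R)|$ is its Lebesgue measure. For $1\le p\le q<\infty$, the (classical) Morrey space $\mathcal{M}^p_q=\mathcal{M}^p_q(\mathbb{R}^d)$ is the set of all measurable (real- or complex-valued) functions $f$ on $\mathbb{R}^d$, identified when equal almost everywhere, such that $$\|f\|_{\mathcal{M}^p_q} := \sup_{a\in \mathbb{R}^d,\ R>0}|B(a,R)|^{\frac{1}{q}-\frac{1}{p}}\biggl(\int_{B(a,R)} |f(y)|^p\, dy\biggr)^{\frac{1}{p}}<\infty.$$ It is a Banach space with this norm. The two signs in $F\pm K\pm U$ are chosen independently of each other, so the inequality is asserted for each of $F+K+U$, $F+K-U$, $F-K+U$, $F-K-U$. *)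

theory Defs
  imports "HOL-Analysis.Analysis"
begin

text \<open>
  The domain R^d is an arbitrary \<^class>\<open>euclidean_space\<close> (so d \<ge> 1 is automatic). The
  codomain is a \<^class>\<open>real_normed_field\<close>: by the Gelfand-Mazur theorem the reals and the complex
  numbers are, up to isomorphism, the only ones.
\<close>

definition morrey_mean ::
  "real \<Rightarrow> real \<Rightarrow> ('a::euclidean_space \<Rightarrow> 'b::real_normed_field) \<Rightarrow> 'a \<Rightarrow> real \<Rightarrow> real"
  where "morrey_mean p q f a R =
    measure lebesgue (ball a R) powr (1/q - 1/p) *
    (LINT y:ball a R|lebesgue. norm (f y) powr p) powr (1/p)"

definition morrey_norm ::
  "real \<Rightarrow> real \<Rightarrow> ('a::euclidean_space \<Rightarrow> 'b::real_normed_field) \<Rightarrow> real"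
  where "morrey_norm p q f = (SUP (a, R) \<in> UNIV \<times> {0<..}. morrey_mean p q f a R)"

text \<open>
  The Bochner integral of a non-integrable function is 0 and the real supremum of an unbounded
  set is unspecified, so finiteness of the supremum is expressed by the last two conjuncts;
  \<^const>\<open>morrey_norm\<close> is meaningful on members of the space only. Members are
  representatives of the almost-everywhere classes, cf. the two congruence lemmas below.
\<close>

definition morrey_space ::
  "real \<Rightarrow> real \<Rightarrow> ('a::euclidean_space \<Rightarrow> 'b::real_normed_field) set"
  where "morrey_space p q = {f. f \<in> borel_measurable lebesgue \<and>
    (\<forall>a. \<forall>R>0. set_integrable lebesgue (ball a R) (\<lambda>y. norm (f y) powr p)) \<and>
    bdd_above ((\<lambda>(a, R). morrey_mean p q f a R) ` (UNIV \<times> {0<..}))}"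

lemma morrey_mean_cong_AE:
  fixes f g :: "'a::euclidean_space \<Rightarrow> 'b::real_normed_field"
  assumes [measurable]: "f \<in> borel_measurable lebesgue" "g \<in> borel_measurable lebesgue"
    and "AE x in lebesgue. f x = g x"
  shows "morrey_mean p q f = morrey_mean p q g"
proof (intro ext)
  fix a :: 'a and R :: real
  have [measurable]: "ball a R \<in> sets lebesgue"
    by simp
  have "(LINT y:ball a R|lebesgue. norm (f y) powr p) = (LINT y:ball a R|lebesgue. norm (g y) powr p)"
    unfolding set_lebesgue_integral_def
    using assms(3) by (intro integral_cong_AE) auto
  then show "morrey_mean p q f a R = morrey_mean p q g a R"
    by (simp add: morrey_mean_def)
qed

lemma morrey_norm_cong_AE:
  fixes f g :: "'a::euclidean_space \<Rightarrow> 'b::real_normed_field"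
  assumes "f \<in> borel_measurable lebesgue" "g \<in> borel_measurable lebesgue"
    and "AE x in lebesgue. f x = g x"
  shows "morrey_norm p q f = morrey_norm p q g"
  using morrey_mean_cong_AE[OF assms] by (simp add: morrey_norm_def)

lemma morrey_space_cong_AE:
  fixes f g :: "'a::euclidean_space \<Rightarrow> 'b::real_normed_field"
  assumes [measurable]: "f \<in> borel_measurable lebesgue" "g \<in> borel_measurable lebesgue"
    and "AE x in lebesgue. f x = g x"
  shows "f \<in> morrey_space p q \<longleftrightarrow> g \<in> morrey_space p q"
proof -
  have "set_integrable lebesgue (ball a R) (\<lambda>y. norm (f y) powr p) \<longleftrightarrow>
        set_integrable lebesgue (ball a R) (\<lambda>y. norm (g y) powr p)" for a :: 'a and R :: real
  proof -
    have [measurable]: "ball a R \<in> sets lebesgue"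
      by simp
    show ?thesis
      unfolding set_integrable_def
      using assms(3) by (intro integrable_cong_AE) auto
  qed
  with morrey_mean_cong_AE[OF assms, of p q] show ?thesis
    using assms(1,2) by (simp add: morrey_space_def)
qed

end

theory Submission
  imports Defs
begin

text \<open>
  For $p < q$ the Morrey space contains isometric copies of the finite-dimensional spaces
  $\ell_\infty^N$, and in $\ell_\infty^4$ there is nothing left to do: the sign vectors
  $(1,1,1,1)$, $(1,1,-1,-1)$ and $(1,-1,1,-1)$ have norm 1, and each of the four combinations
  $F \pm K \pm U$ has a coordinate in which its three terms have the same sign, so its norm is
  exactly 3,
  which exceeds $3 (1 - \delta)$.

  The copy of $\ell_\infty^N$ is spanned by the indicators of $N$ unit balls that are very far
  apart, scaled to norm 1. The norm of a combination is at least the largest absolute value of a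
  coefficient, because the supremum sees each unit ball alone. It is not larger, because
  $|B|^{1/q - 1/p} |B \cap E|^{1/p} \le |B(0,1)|^{1/q}$ for every ball $B$, where $E$ is the union
  of the unit balls (\<open>morrey_quotient_separated_balls\<close>): a ball that meets only one of
  them cannot do better than the unit ball, and a ball that meets two of them is so large that
  the negative power of $|B|$ absorbs the factor $N^{1/p}$. The last point is where $p < q$ enters.
  The isometry itself is \<open>morrey_norm_bump_sum\<close>.
\<close>

section \<open>Measure of a ball intersected with separated unit balls\<close>

lemma powr_exponent_split:
  fixes V :: real
  shows "V powr (1/q - 1/p) * V powr (1/p) = V powr (1/q)"
  by (simp add: powr_add[symmetric])

text \<open>
  The numerical form of the balance between radius and number of unit balls: here $V$ is
  the volume of the unit ball and $V r^n$ that of a ball of radius $r$ in dimension $n$. The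
  condition on $r$ comes from the one-dimensional case, since $r \le r^n$.
\<close>

lemma powr_le_dilation:
  fixes p q V :: real and n :: nat
  assumes "1 \<le> p" "p < q" "V > 0" "n > 0" "r \<ge> 1" "real N powr (1/p) \<le> r powr (1/p - 1/q)"
  shows "(V * r^n) powr (1/q - 1/p) * (real N * V) powr (1/p) \<le> V powr (1/q)"
proof -
  have s: "1/p - 1/q \<ge> 0"
    using assms by (simp add: field_simps)
  have "r \<le> r^n"
    using assms by (simp add: self_le_power)
  then have "real N powr (1/p) \<le> (r^n) powr (1/p - 1/q)"
    using assms s by (meson order_trans powr_mono2 zero_le_one)
  then have "(r^n) powr (1/q - 1/p) * real N powr (1/p)
      \<le> (r^n) powr (1/q - 1/p) * (r^n) powr (1/p - 1/q)"
    by (intro mult_left_mono) auto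
  also have "\<dots> = 1"
    using assms by (simp add: powr_add[symmetric])
  finally have "(r^n) powr (1/q - 1/p) * real N powr (1/p) \<le> 1" .
  then have "((r^n) powr (1/q - 1/p) * real N powr (1/p)) * V powr (1/q) \<le> V powr (1/q)"
    by (simp add: mult_left_le_one_le)
  then show ?thesis
    using assms by (simp add: powr_mult powr_exponent_split[of V q p, symmetric] mult_ac)
qed

text \<open>
  A ball of radius at most 1 satisfies the bound with its own, smaller volume in place of that of
  the unit ball. For a larger ball the previous lemma applies, with a single unit ball if only one
  is met. If two of them are met, the distance of their centers is below $2 R + 2$, which
  forces $R \ge \rho$, and then the crude bound by the total volume of the $N$ unit balls suffices.
\<close>

lemma morrey_quotient_separated_balls:
  fixes z :: "nat \<Rightarrow> 'a::euclidean_space"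
  assumes pq: "1 \<le> p" "p < q" and \<rho>: "\<rho> \<ge> 1" "real N powr (1/p) \<le> \<rho> powr (1/p - 1/q)"
    and sep: "\<And>i j. i < N \<Longrightarrow> j < N \<Longrightarrow> i \<noteq> j \<Longrightarrow> dist (z i) (z j) \<ge> 2 * \<rho> + 2"
    and R: "R > 0"
  shows "measure lebesgue (ball a R) powr (1/q - 1/p) *
      measure lebesgue (ball a R \<inter> (\<Union>i<N. ball (z i) 1)) powr (1/p)
    \<le> unit_ball_vol (real DIM('a)) powr (1/q)"
    (is "?B powr _ * measure _ (_ \<inter> ?E) powr _ \<le> ?V powr _")
proof -
  have V: "?V > 0" by simp
  have B: "?B = ?V * R ^ DIM('a)"
    using R by (simp add: content_ball)
  have unit: "measure lebesgue (ball (z i) 1) = ?V" for i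
    by (simp add: content_ball)
  have mono: "measure lebesgue S \<le> measure lebesgue T"
    if "S \<subseteq> T" "S \<in> lmeasurable" "T \<in> lmeasurable" for S T :: "'a set"
    using that by (simp add: measure_mono_fmeasurable fmeasurableD)
  have E: "?E \<in> lmeasurable" "ball a R \<inter> ?E \<in> lmeasurable"
    by (auto intro!: fmeasurable.finite_UN fmeasurable.Int lmeasurable_ball)
  have q: "0 \<le> 1/q" "0 \<le> 1/p"
    using pq by auto
  consider "R \<le> 1" | i where "R > 1" "i < N" "ball a R \<inter> ?E \<subseteq> ball (z i) 1"
    | "ball a R \<inter> ?E = {}" | "R \<ge> \<rho>"
  proof (cases "\<exists>i<N. \<exists>j<N. i \<noteq> j \<and> ball a R \<inter> ball (z i) 1 \<noteq> {} \<and> ball a R \<inter> ball (z j) 1 \<noteq> {}")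
    case True
    then obtain i j x y where ij: "i < N" "j < N" "i \<noteq> j" "dist a x < R" "dist (z i) x < 1"
        "dist a y < R" "dist (z j) y < 1"
      by (auto simp: set_eq_iff)
    have "dist (z i) (z j) \<le> dist (z i) x + dist a x + dist a y + dist (z j) y"
      by metric
    then have "R \<ge> \<rho>"
      using sep[OF ij(1-3)] ij by linarith
    then show ?thesis using that by blast
  next
    case False
    show ?thesis
    proof (cases "ball a R \<inter> ?E = {}")
      case nonempty: False
      then obtain i where i: "i < N" "ball a R \<inter> ball (z i) 1 \<noteq> {}"
        by blast
      with False have "ball a R \<inter> ?E \<subseteq> ball (z i) 1"
        by blast
      with i that(1,2) show ?thesis
        by (meson not_le)
    qed (use that in blast)
  qed
  then show ?thesis
  proof cases
    case 1
    have "?B powr (1/q - 1/p) * measure lebesgue (ball a R \<inter> ?E) powr (1/p)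
        \<le> ?B powr (1/q - 1/p) * ?B powr (1/p)"
      using mono[OF _ E(2), of "ball a R"] q by (intro mult_left_mono powr_mono2) auto
    also have "\<dots> = ?B powr (1/q)"
      by (rule powr_exponent_split)
    also have "\<dots> \<le> ?V powr (1/q)"
      using 1 R q V unfolding B by (intro powr_mono2 mult_left_le power_le_one) auto
    finally show ?thesis .
  next
    case (2 i)
    have "?B powr (1/q - 1/p) * measure lebesgue (ball a R \<inter> ?E) powr (1/p)
        \<le> ?B powr (1/q - 1/p) * (real 1 * ?V) powr (1/p)"
      using mono[OF 2(3) E(2)] q by (intro mult_left_mono powr_mono2) (auto simp: unit)
    also have "\<dots> \<le> ?V powr (1/q)"
      unfolding B using pq 2 by (intro powr_le_dilation) (auto intro!: ge_one_powr_ge_zero simp: field_simps)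
    finally show ?thesis .
  next
    case 3
    then show ?thesis by simp
  next
    case 4
    have "measure lebesgue (ball a R \<inter> ?E) \<le> measure lebesgue ?E"
      by (rule mono) (use E in auto)
    also have "\<dots> \<le> (\<Sum>i<N. measure lebesgue (ball (z i) 1))"
      by (intro measure_UNION_le) auto
    finally have "measure lebesgue (ball a R \<inter> ?E) \<le> real N * ?V"
      by (simp add: unit)
    then have "?B powr (1/q - 1/p) * measure lebesgue (ball a R \<inter> ?E) powr (1/p)
        \<le> ?B powr (1/q - 1/p) * (real N * ?V) powr (1/p)"
      using q by (intro mult_left_mono powr_mono2) auto
    also have "\<dots> \<le> ?V powr (1/q)"
    proof -
      have "\<rho> powr (1/p - 1/q) \<le> R powr (1/p - 1/q)"
        using 4 \<rho> pq by (intro powr_mono2) (auto simp: field_simps)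
      then show ?thesis
        unfolding B using pq 4 \<rho> by (intro powr_le_dilation) auto
    qed
    finally show ?thesis .
  qed
qed

section \<open>Morrey means of functions comparable to an indicator\<close>

lemma morrey_mean_le_indicator:
  fixes f :: "'a::euclidean_space \<Rightarrow> 'b::real_normed_field"
  assumes p: "1 \<le> p" and [measurable]: "f \<in> borel_measurable lebesgue" "E \<in> sets lebesgue"
    and C: "C \<ge> 0" and le: "\<And>x. norm (f x) \<le> C * indicat_real E x"
  shows "set_integrable lebesgue (ball a R) (\<lambda>y. norm (f y) powr p)"
    and "morrey_mean p q f a R
      \<le> C * (measure lebesgue (ball a R) powr (1/q - 1/p) * measure lebesgue (ball a R \<inter> E) powr (1/p))"
proof -
  have [measurable]: "ball a R \<in> sets lebesgue" by simp
  have fin: "ball a R \<inter> E \<in> lmeasurable"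
    by (rule fmeasurable_Int_fmeasurable) auto
  have int: "integrable lebesgue (\<lambda>y. C powr p * indicat_real (ball a R \<inter> E) y)"
    using fin by (intro integrable_mult_right integrable_real_indicator) (auto simp: fmeasurable_def)
  have bound: "indicat_real (ball a R) y * norm (f y) powr p \<le> C powr p * indicat_real (ball a R \<inter> E) y" for y
    using le[of y] p C by (auto simp: indicator_def powr_mono2 split: if_splits)
  show I: "set_integrable lebesgue (ball a R) (\<lambda>y. norm (f y) powr p)"
    unfolding set_integrable_def
    by (rule Bochner_Integration.integrable_bound[OF int]) (use bound in \<open>auto simp: abs_mult\<close>)
  have "(LINT y:ball a R|lebesgue. norm (f y) powr p) \<le> (LINT y|lebesgue. C powr p * indicat_real (ball a R \<inter> E) y)"
    unfolding set_lebesgue_integral_def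
    by (rule integral_mono) (use I int bound in \<open>auto simp: set_integrable_def\<close>)
  also have "\<dots> = C powr p * measure lebesgue (ball a R \<inter> E)"
    by simp
  finally have "(LINT y:ball a R|lebesgue. norm (f y) powr p) powr (1/p)
      \<le> (C powr p * measure lebesgue (ball a R \<inter> E)) powr (1/p)"
    using p by (intro powr_mono2) (auto simp: set_lebesgue_integral_def intro!: integral_nonneg)
  also have "\<dots> = C * measure lebesgue (ball a R \<inter> E) powr (1/p)"
    using p C by (simp add: powr_mult powr_powr)
  finally have "measure lebesgue (ball a R) powr (1/q - 1/p) * (LINT y:ball a R|lebesgue. norm (f y) powr p) powr (1/p)
      \<le> measure lebesgue (ball a R) powr (1/q - 1/p) * (C * measure lebesgue (ball a R \<inter> E) powr (1/p))"
    by (rule mult_left_mono) simp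
  then show "morrey_mean p q f a R
      \<le> C * (measure lebesgue (ball a R) powr (1/q - 1/p) * measure lebesgue (ball a R \<inter> E) powr (1/p))"
    unfolding morrey_mean_def by (simp only: mult.left_commute)
qed

lemma morrey_mean_const_on_ball:
  fixes f :: "'a::euclidean_space \<Rightarrow> 'b::real_normed_field"
  assumes "1 \<le> p" "C \<ge> 0" and eq: "\<And>y. y \<in> ball a R \<Longrightarrow> norm (f y) = C"
  shows "morrey_mean p q f a R = C * measure lebesgue (ball a R) powr (1/q)"
proof -
  have "(LINT y:ball a R|lebesgue. norm (f y) powr p) = (LINT y:ball a R|lebesgue. C powr p)"
    by (rule set_lebesgue_integral_cong) (auto simp: eq)
  also have "\<dots> = C powr p * measure lebesgue (ball a R)"
    by (simp add: set_lebesgue_integral_def)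
  finally show ?thesis
    using assms powr_exponent_split[of "measure lebesgue (ball a R)" q p]
    by (simp add: morrey_mean_def powr_mult powr_powr mult_ac)
qed

section \<open>An isometric copy of the maximum norm\<close>

text \<open>
  The factor in front, the power $-1/q$ of the volume of the unit ball, gives each single
  indicator Morrey norm 1.
\<close>

definition bump_sum ::
  "real \<Rightarrow> nat \<Rightarrow> (nat \<Rightarrow> 'a::euclidean_space) \<Rightarrow> (nat \<Rightarrow> real) \<Rightarrow> 'a \<Rightarrow> 'b::real_normed_field"
  where "bump_sum q N z t x = of_real
    (unit_ball_vol (real DIM('a)) powr (-1/q) * (\<Sum>k<N. t k * indicat_real (ball (z k) 1) x))"

text \<open>
  On $\mathbb{R}^N$ with the maximum norm, $t \mapsto$ \<open>bump_sum q N z t\<close> is an isometry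
  into the Morrey space: with $M$ the norm of $t$, attained at the index $j$, the modulus of the
  function is dominated by $M$ times the normalised indicator of the union of the balls, and it
  equals this bound on the $j$-th ball.
\<close>

lemma morrey_norm_bump_sum:
  fixes z :: "nat \<Rightarrow> 'a::euclidean_space"
  assumes pq: "1 \<le> p" "p < q" and \<rho>: "\<rho> \<ge> 1" "real N powr (1/p) \<le> \<rho> powr (1/p - 1/q)"
    and sep: "\<And>i j. i < N \<Longrightarrow> j < N \<Longrightarrow> i \<noteq> j \<Longrightarrow> dist (z i) (z j) \<ge> 2 * \<rho> + 2"
    and t: "\<And>k. k < N \<Longrightarrow> \<bar>t k\<bar> \<le> M" and j: "j < N" "\<bar>t j\<bar> = M"
  shows "(bump_sum q N z t :: 'a \<Rightarrow> 'b::real_normed_field) \<in> morrey_space p q"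
    and "morrey_norm p q (bump_sum q N z t :: 'a \<Rightarrow> 'b) = M"
proof -
  define f :: "'a \<Rightarrow> 'b" where "f = bump_sum q N z t"
  define V where "V = unit_ball_vol (real DIM('a))"
  define E where "E = (\<Union>k<N. ball (z k) 1)"
  define C where "C = V powr (-1/q) * M"
  have V: "V > 0" by (simp add: V_def)
  have M: "M \<ge> 0" using j by auto
  have C: "C \<ge> 0" using M by (simp add: C_def)
  have CV: "C * V powr (1/q) = M"
    using V by (simp add: C_def mult.commute mult.left_commute powr_add[symmetric])
  have [measurable]: "ball a R \<in> sets lebesgue" for a :: 'a and R by simp
  have [measurable]: "E \<in> sets lebesgue"
    unfolding E_def by auto
  have meas [measurable]: "f \<in> borel_measurable lebesgue"
    unfolding f_def bump_sum_def[abs_def] by measurable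
  have on_ball: "f x = of_real (V powr (-1/q) * t i)" if "i < N" "x \<in> ball (z i) 1" for i x
  proof -
    have "x \<notin> ball (z k) 1" if "k < N" "k \<noteq> i" for k
    proof
      assume "x \<in> ball (z k) 1"
      then have "dist (z k) (z i) < 2"
        using \<open>x \<in> ball (z i) 1\<close> dist_triangle[of "z k" "z i" x] by (simp add: dist_commute)
      then show False
        using sep[of k i] that \<open>i < N\<close> \<rho> by linarith
    qed
    then have "(\<Sum>k<N. t k * indicat_real (ball (z k) 1) x) = (\<Sum>k<N. if k = i then t i else 0)"
      using that by (intro sum.cong) (auto simp: indicator_def)
    then show ?thesis
      using that by (simp add: f_def bump_sum_def V_def)
  qed
  have off: "f x = 0" if "x \<notin> E" for x
    using that by (simp add: f_def bump_sum_def E_def indicator_def)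
  have le: "norm (f x) \<le> C * indicat_real E x" for x
  proof (cases "x \<in> E")
    case True
    then obtain i where i: "i < N" "x \<in> ball (z i) 1" by (auto simp: E_def)
    then show ?thesis
      using True t[of i] by (simp add: on_ball[OF i] C_def abs_mult mult_left_mono del: of_real_mult)
  qed (simp add: off)
  have upper: "morrey_mean p q f a R \<le> M" if "R > 0" for a R
  proof -
    have "morrey_mean p q f a R \<le> C * (measure lebesgue (ball a R) powr (1/q - 1/p) *
        measure lebesgue (ball a R \<inter> E) powr (1/p))"
      using pq C le by (intro morrey_mean_le_indicator) auto
    also have "\<dots> \<le> C * V powr (1/q)"
      unfolding E_def V_def using C
      by (intro mult_left_mono morrey_quotient_separated_balls[OF pq \<rho> sep that]) auto
    finally show ?thesis by (simp add: CV)
  qed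
  have "morrey_mean p q f (z j) 1 = C * measure lebesgue (ball (z j) 1) powr (1/q)"
    using pq C j by (intro morrey_mean_const_on_ball) (auto simp: on_ball C_def abs_mult simp del: of_real_mult mem_ball)
  then have attained: "morrey_mean p q f (z j) 1 = M"
    using CV by (simp add: content_ball V_def)
  have bdd: "bdd_above ((\<lambda>(a, R). morrey_mean p q f a R) ` (UNIV \<times> {0<..}))"
    using upper by (intro bdd_aboveI[of _ M]) auto
  have "f \<in> morrey_space p q"
    unfolding morrey_space_def using meas bdd morrey_mean_le_indicator(1)[OF pq(1) meas _ C le] by auto
  moreover have "morrey_norm p q f = M"
    unfolding morrey_norm_def
  proof (rule cSup_eq_maximum)
    show "M \<in> (\<lambda>(a, R). morrey_mean p q f a R) ` (UNIV \<times> {0<..})"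
      using attained by (intro image_eqI[of _ _ "(z j, 1)"]) auto
  qed (use upper in auto)
  ultimately show "(bump_sum q N z t :: 'a \<Rightarrow> 'b) \<in> morrey_space p q"
    and "morrey_norm p q (bump_sum q N z t :: 'a \<Rightarrow> 'b) = M"
    by (simp_all add: f_def)
qed

lemma bump_sum_add: "bump_sum q N z s x + bump_sum q N z t x = bump_sum q N z (\<lambda>k. s k + t k) x"
  unfolding bump_sum_def of_real_add[symmetric]
  by (simp add: sum.distrib ring_distribs)

lemma bump_sum_diff: "bump_sum q N z s x - bump_sum q N z t x = bump_sum q N z (\<lambda>k. s k - t k) x"
  unfolding bump_sum_def of_real_diff[symmetric]
  by (simp add: sum_subtractf ring_distribs)

section \<open>Three unit vectors with large signed sums\<close>

theorem theorem3p1: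
  fixes p q \<delta> :: real
  assumes "1 \<le> p" and "p < q" and "\<delta> > 0"
  shows "\<exists>F K U :: 'a::euclidean_space \<Rightarrow> 'b::real_normed_field.
    F \<in> morrey_space p q \<and> K \<in> morrey_space p q \<and> U \<in> morrey_space p q \<and>
    morrey_norm p q F = 1 \<and> morrey_norm p q K = 1 \<and> morrey_norm p q U = 1 \<and>
    morrey_norm p q (\<lambda>x. F x + K x + U x) > 3 * (1 - \<delta>) \<and>
    morrey_norm p q (\<lambda>x. F x + K x - U x) > 3 * (1 - \<delta>) \<and>
    morrey_norm p q (\<lambda>x. F x - K x + U x) > 3 * (1 - \<delta>) \<and>
    morrey_norm p q (\<lambda>x. F x - K x - U x) > 3 * (1 - \<delta>)"
proof -
  \<comment> \<open>The solution of \<open>4 powr (1/p) = \<rho> powr (1/p - 1/q)\<close>; it exists because \<open>p < q\<close>.\<close>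
  define \<rho> :: real where "\<rho> = 4 powr ((1/p) / (1/p - 1/q))"
  have s: "1/p - 1/q > 0"
    using assms by (simp add: field_simps)
  have \<rho>: "\<rho> \<ge> 1" "real 4 powr (1/p) \<le> \<rho> powr (1/p - 1/q)"
    using assms s by (auto simp: \<rho>_def powr_powr intro!: ge_one_powr_ge_zero divide_nonneg_pos)
  obtain b :: 'a where b: "b \<in> Basis"
    using nonempty_Basis by blast
  define z where "z k = (real k * (2 * \<rho> + 2)) *\<^sub>R b" for k
  have sep: "dist (z i) (z j) \<ge> 2 * \<rho> + 2" if "i \<noteq> j" for i j
  proof -
    have "dist (z i) (z j) = \<bar>real i - real j\<bar> * (2 * \<rho> + 2)"
      using b \<rho> by (simp add: z_def dist_norm scaleR_left_diff_distrib[symmetric] abs_mult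
          left_diff_distrib[symmetric])
    moreover have "\<bar>real i - real j\<bar> \<ge> 1"
      using that by linarith
    ultimately show ?thesis
      using \<rho> by simp
  qed
  let ?f = "bump_sum q 4 z :: _ \<Rightarrow> 'a \<Rightarrow> 'b"
  note norm_eq = morrey_norm_bump_sum[OF assms(1,2) \<rho> sep, where 'b = 'b]
  \<comment> \<open>The pairs \<open>(K k, U k)\<close>, \<open>k < 4\<close>, run through all sign patterns, so the \<open>k\<close>-th of the
    four combinations has a coefficient of modulus 3 at \<open>k\<close>.\<close>
  define F K U :: "nat \<Rightarrow> real" where "F k = 1" and "K k = (if k < 2 then 1 else -1)"
    and "U k = (if even k then 1 else -1)" for k
  have unit: "?f t \<in> morrey_space p q \<and> morrey_norm p q (?f t) = 1" if "t \<in> {F, K, U}" for t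
    using that norm_eq[where t = t and M = 1 and j = 0] by (auto simp: F_def K_def U_def)
  have three: "morrey_norm p q (?f t) > 3 * (1 - \<delta>)"
    if "\<And>k. k < 4 \<Longrightarrow> \<bar>t k\<bar> \<le> 3" "j < 4" "\<bar>t j\<bar> = 3" for t j
    using norm_eq(2)[where t = t and M = 3 and j = j] that assms(3) by simp
  show ?thesis
  proof (rule exI[of _ "?f F"], rule exI[of _ "?f K"], rule exI[of _ "?f U"], intro conjI)
    show "morrey_norm p q (\<lambda>x. ?f F x + ?f K x + ?f U x) > 3 * (1 - \<delta>)"
      unfolding bump_sum_add by (rule three[of _ 0]) (auto simp: F_def K_def U_def)
    show "morrey_norm p q (\<lambda>x. ?f F x + ?f K x - ?f U x) > 3 * (1 - \<delta>)"
      unfolding bump_sum_add bump_sum_diff by (rule three[of _ 1]) (auto simp: F_def K_def U_def)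
    show "morrey_norm p q (\<lambda>x. ?f F x - ?f K x + ?f U x) > 3 * (1 - \<delta>)"
      unfolding bump_sum_add bump_sum_diff by (rule three[of _ 2]) (auto simp: F_def K_def U_def)
    show "morrey_norm p q (\<lambda>x. ?f F x - ?f K x - ?f U x) > 3 * (1 - \<delta>)"
      unfolding bump_sum_diff by (rule three[of _ 3]) (auto simp: F_def K_def U_def)
  qed (use unit in auto)
qed

end
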